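(* Let $m\ge 2$ be an integer. Define the projective-plane information quantity $$Q^{P}_{(m)}=\frac12\sum_{i,j=1}^{m}\Big(S\big(A_i^{(j)}B_{i+j-1}^{(m-j)}\big)+S\big(A_i^{(j)}B_{i+j}^{(m-j)}\big)\Big)-\sum_{i,j=1}^{m}S\big(A_i^{(j-1)}B_{i+j-1}^{(m-j)}\big)-S(A_1A_2\cdots A_m).$$ Then $Q^P_{(m)}$ is TF-compatible (with $B_m$ as the purifier), and explicitly $$Q^P_{(m)}=\sum_{i=1}^{m-1}\sum_{j=i}^{m-1}-I_3\big(A_i:B_j:A_{j+1}^{(m-j)}\,\big|\,A_1^{(i-1)}B_i^{(j-i)}\big).$$
   Context: The parties are $2m$ distinct elements $A_1,\dots,A_m,B_1,\dots,B_m$. A subsystem is a subset of the set of parties; juxtaposition denotes union. $S$ is an arbitrary real-valued function on subsystems with $S(\emptyset)=0$ and satisfying purity: $S(X)=S(\overline X)$, where $\overline X$ is the complement of $X$ in the set of all $2m$ parties. All identities are understood to hold for every such $S$. One party is designated as the purifier ($B_m$ here); by purity, every entropy can be written as the entropy of a subset of the remaining $\mathsf N=2m-1$ parties. Indices are cyclic: $A_{i+m}=A_i$, $B_{j+m}=B_j$. For $k\ge 0$, $A_i^{(k)}=A_iA_{i+1}\cdots A_{i+k-1}$ and $B_j^{(k)}=B_jB_{j+1}\cdots B_{j+k-1}$ (empty if $k=0$). For pairwise disjoint subsystems $X,Y,Z,W$, the conditional tripartite information is $$I_3(X:Y:Z\,|\,W)=S(XW)+S(YW)+S(ZW)+S(XYZW)-S(XYW)-S(XZW)-S(YZW)-S(W),$$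 and $I_3(X:Y:Z)=I_3(X:Y:Z\,|\,\emptyset)$. An information quantity (linear combination of entropies) is TF-compatible if it can be written as a finite sum $\sum_i -I_3(X_i:Y_i:Z_i\,|\,W_i)$ where, for each $i$, $X_i,Y_i,Z_i,W_i$ are pairwise disjoint subsystems not containing the purifier ($W_i=\emptyset$ allowed; repetition of terms allowed). *)

theory Defs
  imports Complex_Main
begin

text \<open>The parties are the values of two cyclically indexed families \<open>A\<close>, \<open>B\<close> on an
  arbitrary type; one period \<open>1, \<dots>, m\<close> of each family lists \<open>m\<close> distinct elements.\<close>

definition cyclic_parties :: "nat \<Rightarrow> (nat \<Rightarrow> 'p) \<Rightarrow> (nat \<Rightarrow> 'p) \<Rightarrow> bool" where
  "cyclic_parties m A B \<longleftrightarrow>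
     (\<forall>i. A (i + m) = A i) \<and> (\<forall>j. B (j + m) = B j) \<and>
     inj_on A {1..m} \<and> inj_on B {1..m} \<and> A ` {1..m} \<inter> B ` {1..m} = {}"

definition parties :: "nat \<Rightarrow> (nat \<Rightarrow> 'p) \<Rightarrow> (nat \<Rightarrow> 'p) \<Rightarrow> 'p set" where
  "parties m A B = A ` {1..m} \<union> B ` {1..m}"

text \<open>\<open>block A i k\<close> is \<open>A\<^sub>i A\<^sub>i\<^sub>+\<^sub>1 \<dots> A\<^sub>i\<^sub>+\<^sub>k\<^sub>-\<^sub>1\<close>, empty for \<open>k = 0\<close>.\<close>

definition block :: "(nat \<Rightarrow> 'p) \<Rightarrow> nat \<Rightarrow> nat \<Rightarrow> 'p set" where
  "block A i k = A ` {i..<i + k}"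

text \<open>Only the values of \<open>S\<close> on subsets of \<open>P\<close> are constrained and ever used.\<close>

definition pure_entropy :: "'p set \<Rightarrow> ('p set \<Rightarrow> real) \<Rightarrow> bool" where
  "pure_entropy P S \<longleftrightarrow> S {} = 0 \<and> (\<forall>X. X \<subseteq> P \<longrightarrow> S X = S (P - X))"

definition cond_I3 :: "('p set \<Rightarrow> real) \<Rightarrow> 'p set \<Rightarrow> 'p set \<Rightarrow> 'p set \<Rightarrow> 'p set \<Rightarrow> real" where
  "cond_I3 S X Y Z W =
     S (X \<union> W) + S (Y \<union> W) + S (Z \<union> W) + S (X \<union> Y \<union> Z \<union> W)
     - S (X \<union> Y \<union> W) - S (X \<union> Z \<union> W) - S (Y \<union> Z \<union> W) - S W"

definition admissible ::
  "'p set \<Rightarrow> 'p \<Rightarrow> 'p set \<Rightarrow> 'p set \<Rightarrow> 'p set \<Rightarrow> 'p set \<Rightarrow> bool" where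
  "admissible P p X Y Z W \<longleftrightarrow>
     X \<union> Y \<union> Z \<union> W \<subseteq> P - {p} \<and>
     X \<inter> Y = {} \<and> X \<inter> Z = {} \<and> X \<inter> W = {} \<and> Y \<inter> Z = {} \<and> Y \<inter> W = {} \<and> Z \<inter> W = {}"

text \<open>An information quantity is represented by the functional it induces on entropy functions;
  two of them are identified when they agree for every \<open>S\<close> with \<open>S \<emptyset> = 0\<close> and purity.
  The list allows repeated terms. A functional satisfying the condition is, on such \<open>S\<close>,
  automatically a linear combination of entropies of subsets of \<open>P\<close>.\<close>

definition TF_compatible :: "'p set \<Rightarrow> 'p \<Rightarrow> (('p set \<Rightarrow> real) \<Rightarrow> real) \<Rightarrow> bool" where
  "TF_compatible P p Q \<longleftrightarrow>
     (\<exists>ts. (\<forall>(X, Y, Z, W) \<in> set ts. admissible P p X Y Z W) \<and>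
           (\<forall>S. pure_entropy P S \<longrightarrow> Q S = (\<Sum>(X, Y, Z, W)\<leftarrow>ts. - cond_I3 S X Y Z W)))"

text \<open>Since \<open>1 \<le> i, j \<le> m\<close> in the sums, no subtraction on indices is truncated.\<close>

definition Q_proj ::
  "nat \<Rightarrow> (nat \<Rightarrow> 'p) \<Rightarrow> (nat \<Rightarrow> 'p) \<Rightarrow> ('p set \<Rightarrow> real) \<Rightarrow> real" where
  "Q_proj m A B S =
     1 / 2 * (\<Sum>i = 1..m. \<Sum>j = 1..m.
        S (block A i j \<union> block B (i + j - 1) (m - j)) + S (block A i j \<union> block B (i + j) (m - j)))
     - (\<Sum>i = 1..m. \<Sum>j = 1..m. S (block A i (j - 1) \<union> block B (i + j - 1) (m - j)))
     - S (block A 1 m)"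

end

theory Submission
  imports Defs
begin

text \<open>With \<open>X\<close>, \<open>Y\<close>, \<open>Z\<close>, \<open>W\<close> as in the \<open>(i, j)\<close> term, the four entropies not involving \<open>Z\<close>
  telescope in \<open>j\<close>. Of the other four, \<open>XZW\<close> and \<open>YZW\<close> are cyclic intervals of the two kinds
  occurring with weight one half in \<open>Q\<close>, while \<open>ZW\<close> and the complement of \<open>XYZW\<close> are intervals of
  the negative kind. Together with the telescoped boundary terms, the latter exhaust the negative
  kind exactly once. The former meet each orbit of the complementation, which acts on either
  positive kind by \<open>(s, t) \<mapsto> (s + t, m - t)\<close>, exactly once, and this accounts for the
  factor one half.\<close>

section \<open>Cyclic intervals and their complements\<close>

lemma block_append: "block A i (k + l) = block A i k \<union> block A (i + k) l"
proof -
  have "{i..<i + (k + l)} = {i..<i + k} \<union> {i + k..<i + k + l}" by auto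
  then show ?thesis by (simp add: block_def image_Un)
qed

lemma block_1 [simp]: "block A i (Suc 0) = {A i}"
  by (simp add: block_def)

lemma block_0 [simp]: "block A i 0 = {}"
  by (simp add: block_def)

lemma block_shift:
  assumes "\<forall>i. A (i + m) = A i"
  shows "block A (i + m) k = block A i k"
proof -
  have "{i + m..<i + m + k} = (\<lambda>x. x + m) ` {i..<i + k}" by (simp add: ac_simps)
  then have "block A (i + m) k = (\<lambda>x. A (x + m)) ` {i..<i + k}"
    by (simp only: block_def image_image)
  also have "\<dots> = block A i k" using assms by (simp add: block_def)
  finally show ?thesis .
qed

text \<open>Moving a window of length \<open>m\<close> by one step exchanges \<open>A s\<close> for
  the equal \<open>A (s + m)\<close>, so all such windows have the same image.\<close>

lemma block_period:
  assumes "\<forall>i. A (i + m) = A i"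
  shows "block A s m = A ` {1..m}"
proof -
  have step: "block A (Suc s) m = block A s m" for s
  proof (cases m)
    case (Suc k)
    have "block A (Suc s) (k + 1) = block A (Suc s) k \<union> {A (s + m)}"
      by (simp only: block_append) (simp add: Suc)
    moreover have "block A s (1 + k) = {A s} \<union> block A (Suc s) k"
      by (simp only: block_append) simp
    moreover have "A (s + m) = A s" using assms by blast
    ultimately show ?thesis by (simp add: Suc)
  qed simp
  have "block A s m = block A 0 m" for s by (induction s) (simp_all add: step)
  then have "block A s m = block A 1 m" by metis
  also have "\<dots> = A ` {1..m}" by (simp add: block_def atLeastLessThanSuc_atLeastAtMost)
  finally show ?thesis .
qed

text \<open>The image of a full period has \<open>m\<close> elements, so \<open>A\<close> is
  injective on every window of \<open>m\<close> consecutive indices, not only on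
  \<open>{1..m}\<close>. Hence the difference can be computed on the indices of the window starting
  at \<open>s\<close>.\<close>

lemma block_complement:
  assumes per: "\<forall>i. A (i + m) = A i" and inj: "inj_on A {1..m}" and "t \<le> m"
  shows "A ` {1..m} - block A s t = block A (s + t) (m - t)"
proof -
  have "A ` {s..<s + m} = A ` {1..m}"
    using block_period[OF per] by (simp add: block_def)
  moreover have "card (A ` {1..m}) = m" using inj by (simp add: card_image)
  ultimately have inj': "inj_on A {s..<s + m}" by (intro eq_card_imp_inj_on) auto
  have "A ` {1..m} - block A s t = A ` {s..<s + m} - A ` {s..<s + t}"
    using block_period[OF per, of s] by (simp add: block_def)
  also have "\<dots> = A ` ({s..<s + m} - {s..<s + t})"
    using inj' \<open>t \<le> m\<close> by (intro inj_on_image_set_diff[symmetric]) auto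
  also have "{s..<s + m} - {s..<s + t} = {s + t..<s + t + (m - t)}"
    using \<open>t \<le> m\<close> by auto
  finally show ?thesis by (simp add: block_def)
qed

lemma block_subset:
  assumes "\<forall>i. A (i + m) = A i" and "t \<le> m"
  shows "block A s t \<subseteq> A ` {1..m}"
proof -
  have "block A s m = block A s t \<union> block A (s + t) (m - t)"
    using block_append[of A s t "m - t"] \<open>t \<le> m\<close> by simp
  then show ?thesis using block_period[OF assms(1), of s] by auto
qed

text \<open>Purity passes to the complement. Since the two families are disjoint, it splits into one
  complement in each family, and both are again cyclic intervals.\<close>

lemma entropy_complement:
  assumes cyc: "cyclic_parties m A B" and pure: "pure_entropy (parties m A B) S"
    and "t \<le> m" "v \<le> m"
  shows "S (block A s t \<union> block B u v) =
    S (block A (s + t) (m - t) \<union> block B (u + v) (m - v))"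
proof -
  have pA: "\<forall>i. A (i + m) = A i" and pB: "\<forall>i. B (i + m) = B i"
    and iA: "inj_on A {1..m}" and iB: "inj_on B {1..m}"
    and disj: "A ` {1..m} \<inter> B ` {1..m} = {}"
    using cyc by (auto simp: cyclic_parties_def)
  have sA: "block A s t \<subseteq> A ` {1..m}" and sB: "block B u v \<subseteq> B ` {1..m}"
    using block_subset[OF pA assms(3)] block_subset[OF pB assms(4)] by blast+
  have "S (block A s t \<union> block B u v) = S (parties m A B - (block A s t \<union> block B u v))"
  proof -
    have "block A s t \<union> block B u v \<subseteq> parties m A B"
      unfolding parties_def using sA sB by (rule Un_mono)
    then show ?thesis using pure unfolding pure_entropy_def by metis
  qed
  also have "parties m A B - (block A s t \<union> block B u v) =
      (A ` {1..m} - block A s t) \<union> (B ` {1..m} - block B u v)"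
  proof -
    have "A ` {1..m} \<inter> block B u v = {}" "B ` {1..m} \<inter> block A s t = {}"
      using disj sA sB by blast+
    then show ?thesis unfolding parties_def by blast
  qed
  also have "\<dots> = block A (s + t) (m - t) \<union> block B (u + v) (m - v)"
    using block_complement[OF pA iA] block_complement[OF pB iB] assms(3,4) by simp
  finally show ?thesis .
qed

section \<open>Reindexing of finite double sums\<close>

lemma sum_triangle_swap:
  fixes f :: "nat \<Rightarrow> nat \<Rightarrow> 'a::comm_monoid_add"
  shows "(\<Sum>i = 1..n. \<Sum>j = i..n. f i j) = (\<Sum>j = 1..n. \<Sum>i = 1..j. f i j)"
proof -
  have "(\<Sum>(i, j)\<in>(SIGMA i:{1..n}. {i..n}). f i j) =
      (\<Sum>(j, i)\<in>(SIGMA j:{1..n}. {1..j}). f i j)"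
    by (rule sum.reindex_bij_witness[where i = prod.swap and j = prod.swap]) auto
  then show ?thesis by (simp add: sum.Sigma)
qed

text \<open>The involution \<open>(s, t) \<mapsto> (s + t, m - t)\<close> exchanges the two halves
  \<open>s + t \<le> m\<close> and \<open>s + t > m\<close> of the index square.\<close>

lemma sum_involution:
  fixes f :: "nat \<Rightarrow> nat \<Rightarrow> real"
  assumes "m \<ge> 1" and per: "\<And>s t. f (s + m) t = f s t"
    and inv: "\<And>s t. 1 \<le> t \<Longrightarrow> t \<le> m \<Longrightarrow> f s t = f (s + t) (m - t)"
  shows "(\<Sum>s = 1..m. \<Sum>t = 1..m - 1. f s t) =
    2 * (\<Sum>s = 1..m. \<Sum>t = m - s + 1..m - 1. f s t)"
proof -
  \<comment> \<open>On the half \<open>s + t \<le> m\<close> the new start \<open>s + t\<close> is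
    already in range; on the other half it exceeds \<open>m\<close>, so the inverse subtracts one
    period.\<close>
  have "(\<Sum>(s, t)\<in>(SIGMA s:{1..m}. {1..m - s}). f s t) =
      (\<Sum>(s, t)\<in>(SIGMA s:{1..m}. {m - s + 1..m - 1}). f s t)"
    by (rule sum.reindex_bij_witness
        [where i = "\<lambda>(s, t). (s + t - m, m - t)" and j = "\<lambda>(s, t). (s + t, m - t)"])
      (auto simp: inv[symmetric])
  then have half: "(\<Sum>s = 1..m. \<Sum>t = 1..m - s. f s t) =
      (\<Sum>s = 1..m. \<Sum>t = m - s + 1..m - 1. f s t)"
    by (simp add: sum.Sigma)
  have "(\<Sum>t = 1..m - 1. f s t) = (\<Sum>t = 1..m - s. f s t) + (\<Sum>t = m - s + 1..m - 1. f s t)"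
    if "s \<in> {1..m}" for s
  proof -
    have "{1..m - 1} = {1..m - s} \<union> {m - s + 1..m - 1}" using that by auto
    then show ?thesis by (simp add: sum.union_disjoint)
  qed
  then have "(\<Sum>s = 1..m. \<Sum>t = 1..m - 1. f s t) =
      (\<Sum>s = 1..m. (\<Sum>t = 1..m - s. f s t) + (\<Sum>t = m - s + 1..m - 1. f s t))"
    by (intro sum.cong) auto
  then show ?thesis using half by (simp add: sum.distrib)
qed

text \<open>Serves to pass from starting points \<open>1..m\<close> to the starting points lowered
  by one that index \<open>g\<close> and \<open>h\<close> below.\<close>

lemma sum_cyclic_shift:
  fixes f :: "nat \<Rightarrow> real"
  assumes "f m = f 0"
  shows "(\<Sum>i = 1..m. f (i - 1)) = (\<Sum>i = 1..m. f i)"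
proof (cases m)
  case (Suc n)
  have "(\<Sum>i = 1..m. f (i - 1)) = (\<Sum>i = 0..n. f i)"
    by (rule sum.reindex_bij_witness[where i = Suc and j = "\<lambda>i. i - 1"]) (auto simp: Suc)
  also have "\<dots> = f 0 + (\<Sum>i = 1..n. f i)" by (simp add: sum.atLeast_Suc_atMost)
  also have "\<dots> = (\<Sum>i = 1..m. f i)" using assms by (simp add: Suc)
  finally show ?thesis .
qed simp

section \<open>The terms of the decomposition\<close>

text \<open>All indices lie in the single period \<open>{1..m}\<close>, so disjointness reduces to
  that of index sets within each family. The purifier \<open>B m\<close> is avoided because the
  \<open>B\<close> indices are at most \<open>j < m\<close>.\<close>

lemma admissible_term:
  assumes cyc: "cyclic_parties m A B" and "i \<in> {1..m - 1}" "j \<in> {i..m - 1}"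
  shows "admissible (parties m A B) (B m)
    {A i} {B j} (block A (j + 1) (m - j)) (block A 1 (i - 1) \<union> block B i (j - i))"
proof -
  have iA: "inj_on A {1..m}" and iB: "inj_on B {1..m}"
    and disj: "A ` {1..m} \<inter> B ` {1..m} = {}"
    using cyc by (auto simp: cyclic_parties_def)
  have A: "A ` U \<inter> A ` V = {}" if "U \<subseteq> {1..m}" "V \<subseteq> {1..m}" "U \<inter> V = {}" for U V
    using inj_on_image_Int[OF iA that(1,2)] that(3) by simp
  have B: "B ` U \<inter> B ` V = {}" if "U \<subseteq> {1..m}" "V \<subseteq> {1..m}" "U \<inter> V = {}" for U V
    using inj_on_image_Int[OF iB that(1,2)] that(3) by simp
  have AB: "A ` U \<inter> B ` V = {}" if "U \<subseteq> {1..m}" "V \<subseteq> {1..m}" for U V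
    using disj that by blast
  let ?i = "{i}" and ?j = "{j}" and ?Z = "{j + 1..m}" and ?V = "{1..i - 1}" and ?W = "{i..<j}"
  have sub: "?i \<subseteq> {1..m}" "?j \<subseteq> {1..m}" "?Z \<subseteq> {1..m}" "?V \<subseteq> {1..m}" "?W \<subseteq> {1..m}" "{m} \<subseteq> {1..m}"
    using assms(2,3) by auto
  have ZVW: "block A (j + 1) (m - j) = A ` ?Z" "block A 1 (i - 1) = A ` ?V" "block B i (j - i) = B ` ?W"
    using assms(2,3) by (auto simp: block_def intro!: arg_cong[where f = "image A"])
  have parts: "A ` U \<subseteq> parties m A B" "B ` U \<subseteq> parties m A B" if "U \<subseteq> {1..m}" for U
    using that by (auto simp: parties_def)
  have "?i \<inter> ?Z = {}" "?i \<inter> ?V = {}" "?Z \<inter> ?V = {}" "?j \<inter> ?W = {}" "?j \<inter> {m} = {}" "?W \<inter> {m} = {}"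
    using assms(2,3) by auto
  note d = A[OF sub(1,3) this(1)] A[OF sub(1,4) this(2)] A[OF sub(3,4) this(3)]
    B[OF sub(2,5) this(4)] B[OF sub(2,6) this(5)] B[OF sub(5,6) this(6)]
    AB[OF sub(1,2)] AB[OF sub(1,5)] AB[OF sub(1,6)] AB[OF sub(3,2)] AB[OF sub(3,5)] AB[OF sub(3,6)]
    AB[OF sub(4,2)] AB[OF sub(4,6)]
  have "admissible (parties m A B) (B m) (A ` ?i) (B ` ?j) (A ` ?Z) (A ` ?V \<union> B ` ?W)"
    using d parts(1)[OF sub(1)] parts(1)[OF sub(3)] parts(1)[OF sub(4)]
      parts(2)[OF sub(2)] parts(2)[OF sub(5)]
    unfolding admissible_def
    by (simp add: Int_Un_distrib Int_commute subset_Diff_insert)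
  then show ?thesis unfolding ZVW by simp
qed

text \<open>Connects the list of terms demanded by \<open>TF_compatible\<close> with the triangular
  double sum of the explicit formula.\<close>

lemma sum_list_concat_triangle:
  fixes f :: "nat \<Rightarrow> nat \<Rightarrow> real"
  assumes "m \<ge> 1"
  shows "(\<Sum>x\<leftarrow>concat (map (\<lambda>i. map (g i) [i..<m]) [1..<m]). F x) =
    (\<Sum>i = 1..m - 1. \<Sum>j = i..m - 1. F (g i j) :: real)"
proof -
  have "{i..m - 1} = {i..<m}" for i using assms by auto
  moreover have "sum_list (map F (concat (map (\<lambda>i. map (g i) [i..<m]) is))) =
      (\<Sum>i\<leftarrow>is. \<Sum>j = i..<m. F (g i j))" for "is"
    by (induction "is") (simp_all add: comp_def interv_sum_list_conv_sum_set_nat)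
  ultimately show ?thesis by (simp add: interv_sum_list_conv_sum_set_nat)
qed

text \<open>\<open>g\<close>, \<open>b\<close> and \<open>h\<close> are the three kinds of entropies in \<open>Q_proj\<close>; the first index of \<open>g\<close> and
  \<open>h\<close> is the starting point in \<open>A\<close> lowered by one, which avoids truncated subtraction and makes
  the complementation act in the same way on \<open>g\<close> and \<open>b\<close>.\<close>

lemma cond_I3_term:
  fixes S :: "'p set \<Rightarrow> real"
  assumes cyc: "cyclic_parties m A B" and pure: "pure_entropy (parties m A B) S"
    and i: "1 \<le> i" "i \<le> j" "j < m"
  defines "g \<equiv> \<lambda>s t. S (block A (s + 1) t \<union> block B (s + t) (m - t))"
    and "b \<equiv> \<lambda>s t. S (block A s t \<union> block B (s + t) (m - t))"
    and "h \<equiv> \<lambda>s t. S (block A (s + 1) (t - 1) \<union> block B (s + t) (m - t))"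
    and "G \<equiv> \<lambda>k. S (block A 1 i \<union> block B i (k - i)) - S (block A 1 (i - 1) \<union> block B i (k - i))"
  shows "- cond_I3 S {A i} {B j} (block A (j + 1) (m - j)) (block A 1 (i - 1) \<union> block B i (j - i)) =
    (G (Suc j) - G j) + g j (m - j + i) + b (Suc j) (m - j + i - 1)
      - h j (m - j + i) - h i (j - i + 1)"
proof -
  have pA: "\<forall>i. A (i + m) = A i" and pB: "\<forall>i. B (i + m) = B i"
    using cyc by (auto simp: cyclic_parties_def)
  have sA: "block A (m + x) k = block A x k" for x k
    using block_shift[OF pA, of x k] by (simp add: add.commute)
  have sB: "block B (m + x) k = block B x k" for x k
    using block_shift[OF pB, of x k] by (simp add: add.commute)
  have A1: "block A 1 i = block A 1 (i - 1) \<union> {A i}"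
    using block_append[of A 1 "i - 1" 1] i by simp
  have B1: "block B i (Suc j - i) = block B i (j - i) \<union> {B j}"
    using block_append[of B i "j - i" 1] i by (simp add: Suc_diff_le)
  \<comment> \<open>The block from \<open>j + 1\<close> ends at \<open>A m\<close>, and by
    periodicity \<open>A 1\<close> follows. Thus \<open>Z\<close> and an initial block of
    \<open>A\<close> merge into one cyclic interval.\<close>
  have A2: "block A (j + 1) (m - j + k) = block A (j + 1) (m - j) \<union> block A 1 k" for k
    using block_append[of A "j + 1" "m - j" k] sA[of 1 k] i by simp
  let ?Z = "block A (j + 1) (m - j)" and ?W = "block A 1 (i - 1) \<union> block B i (j - i)"
  \<comment> \<open>Adjoining \<open>B j\<close> to \<open>W\<close> is the passage from
    \<open>k = j\<close> to \<open>k = Suc j\<close> in \<open>G\<close>, and adjoining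
    \<open>A i\<close> gives the difference inside \<open>G\<close>.\<close>
  have XW: "S ({A i} \<union> ?W) = S (block A 1 i \<union> block B i (j - i))"
    unfolding A1 by (simp add: Un_ac)
  have YW: "S ({B j} \<union> ?W) = S (block A 1 (i - 1) \<union> block B i (Suc j - i))"
    unfolding B1 by (simp add: Un_ac)
  have XYW: "S ({A i} \<union> {B j} \<union> ?W) = S (block A 1 i \<union> block B i (Suc j - i))"
    unfolding A1 B1 by (simp add: Un_ac insert_commute)
  have ZW: "S (?Z \<union> ?W) = h j (m - j + i)"
  proof -
    have "?Z \<union> ?W = block A (j + 1) (m - j + (i - 1)) \<union> block B (m + i) (j - i)"
      unfolding A2 sB by (simp add: Un_ac)
    then show ?thesis using i by (simp add: h_def)
  qed
  have XZW: "S ({A i} \<union> ?Z \<union> ?W) = g j (m - j + i)"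
  proof -
    have "{A i} \<union> ?Z \<union> ?W = block A (j + 1) (m - j + i) \<union> block B (m + i) (j - i)"
      unfolding A2 sB A1 by (simp add: Un_ac insert_commute)
    then show ?thesis using i by (simp add: g_def)
  qed
  have YZW: "S ({B j} \<union> ?Z \<union> ?W) = b (Suc j) (m - j + i - 1)"
  proof -
    have "{B j} \<union> ?Z \<union> ?W = block A (j + 1) (m - j + (i - 1)) \<union> block B (m + i) (Suc j - i)"
      unfolding A2 sB B1 by (simp add: Un_ac insert_commute)
    moreover have "m - (m - j + i - 1) = Suc j - i" "Suc j + (m - j + i - 1) = m + i" using i by auto
    ultimately show ?thesis using i by (simp add: b_def)
  qed
  have XYZW: "S ({A i} \<union> {B j} \<union> ?Z \<union> ?W) = h i (j - i + 1)"
  proof -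
    have "{A i} \<union> {B j} \<union> ?Z \<union> ?W = block A (j + 1) (m - j + i) \<union> block B i (Suc j - i)"
      unfolding A2 B1 A1 by (simp add: Un_ac insert_commute)
    \<comment> \<open>\<open>XYZW\<close> has \<open>m + 1\<close> parties, while \<open>h\<close>
      counts intervals with \<open>m - 1\<close>; so the complement is taken here.\<close>
    then have "S ({A i} \<union> {B j} \<union> ?Z \<union> ?W) =
        S (block A (j + 1 + (m - j + i)) (m - (m - j + i)) \<union> block B (i + (Suc j - i)) (m - (Suc j - i)))"
      using entropy_complement[OF cyc pure, of "m - j + i" "Suc j - i" "j + 1" i] i by simp
    also have "j + 1 + (m - j + i) = m + (i + 1)" using i by simp
    also have "m - (m - j + i) = j - i + 1 - 1" using i by simp
    also have "Suc j - i = j - i + 1" using i by simp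
    finally show ?thesis unfolding sA h_def .
  qed
  show ?thesis
    unfolding cond_I3_def XW YW XYW ZW XZW YZW XYZW G_def by simp
qed

section \<open>Summation over the triangle of terms\<close>

lemma Q_proj_eq_sum:
  fixes S :: "'p set \<Rightarrow> real"
  assumes m: "m \<ge> 2" and cyc: "cyclic_parties m A B" and pure: "pure_entropy (parties m A B) S"
  shows "Q_proj m A B S =
    (\<Sum>i = 1..m - 1. \<Sum>j = i..m - 1.
       - cond_I3 S {A i} {B j} (block A (j + 1) (m - j)) (block A 1 (i - 1) \<union> block B i (j - i)))"
proof -
  have pA: "\<forall>i. A (i + m) = A i" and pB: "\<forall>i. B (i + m) = B i"
    using cyc by (auto simp: cyclic_parties_def)
  have sA: "block A (m + x) k = block A x k" "block A (x + m) k = block A x k"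
    "block A (Suc (x + m)) k = block A (Suc x) k" "block A (Suc m) k = block A (Suc 0) k" for x k
    using block_shift[OF pA, of x k] block_shift[OF pA, of "Suc x" k] block_shift[OF pA, of "Suc 0" k]
    by (simp_all add: add.commute)
  have sB: "block B (m + x) k = block B x k" "block B (x + m) k = block B x k" for x k
    using block_shift[OF pB, of x k] by (simp_all add: add.commute)
  define g where "g \<equiv> \<lambda>s t. S (block A (s + 1) t \<union> block B (s + t) (m - t))"
  define b where "b \<equiv> \<lambda>s t. S (block A s t \<union> block B (s + t) (m - t))"
  define h where "h \<equiv> \<lambda>s t. S (block A (s + 1) (t - 1) \<union> block B (s + t) (m - t))"
  define G where "G \<equiv> \<lambda>i k. S (block A 1 i \<union> block B i (k - i)) -
    S (block A 1 (i - 1) \<union> block B i (k - i))"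
  define K where "K = S (block A 1 m)"
  have sB': "block B (x + m + y) k = block B (x + y) k" for x y k
    using sB(2)[of "x + y" k] by (simp add: add.commute add.left_commute)
  have gper: "g (s + m) t = g s t" and bper: "b (s + m) t = b s t" and hper: "h (s + m) t = h s t"
    for s t by (simp_all add: g_def b_def h_def sA sB')
  have ginv: "g s t = g (s + t) (m - t)" and binv: "b s t = b (s + t) (m - t)" if "t \<le> m" for s t
    using entropy_complement[OF cyc pure, of t "m - t" "s + 1" "s + t"]
      entropy_complement[OF cyc pure, of t "m - t" s "s + t"] that
    by (simp_all add: g_def b_def)
  \<comment> \<open>The column \<open>t = m\<close> consists of the whole family \<open>A\<close>
    for every start. It is kept apart because the involution sends it to \<open>t = 0\<close>,
    outside the index square.\<close>
  have K: "g s m = K" "b s m = K" for s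
    using block_period[OF pA] by (simp_all add: g_def b_def K_def)
  \<comment> \<open>\<open>Tg\<close> and \<open>Tb\<close> are the halves \<open>s + t > m\<close>
    of the positive entropies with \<open>t < m\<close>; \<open>Th\<close> is the full square of
    negative ones.\<close>
  define Tg where "Tg = (\<Sum>j = 1..m. \<Sum>t = m - j + 1..m - 1. g j t)"
  define Tb where "Tb = (\<Sum>j = 1..m. \<Sum>t = m - j + 1..m - 1. b j t)"
  define Th where "Th = (\<Sum>s = 1..m. \<Sum>t = 1..m. h s t)"
  have S0: "S {} = 0" using pure by (simp add: pure_entropy_def)
  have Suc_m: "Suc (m - 1) = m" using m by simp
  have split_last: "(\<Sum>t = k..m. f t) = (\<Sum>t = k..m - 1. f t) + f m" if "k \<le> m"
    for f :: "nat \<Rightarrow> real" and k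
    using sum.cl_ivl_Suc[of f k "m - 1"] that m by simp

  have Qg: "(\<Sum>i = 1..m. \<Sum>j = 1..m. S (block A i j \<union> block B (i + j - 1) (m - j))) = 2 * Tg + m * K"
  proof -
    have "(\<Sum>i = 1..m. \<Sum>j = 1..m. S (block A i j \<union> block B (i + j - 1) (m - j))) =
        (\<Sum>i = 1..m. \<Sum>j = 1..m. g (i - 1) j)"
      by (intro sum.cong) (auto simp: g_def)
    also have "\<dots> = (\<Sum>i = 1..m. \<Sum>j = 1..m. g i j)"
      using gper[of 0] by (intro sum_cyclic_shift[of "\<lambda>i. \<Sum>j = 1..m. g i j"]) simp
    also have "\<dots> = (\<Sum>i = 1..m. \<Sum>j = 1..m - 1. g i j) + m * K"
      using m by (simp add: split_last K sum.distrib)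
    finally show ?thesis unfolding Tg_def
      using sum_involution[OF _ gper ginv] m by simp
  qed
  have Qb: "(\<Sum>i = 1..m. \<Sum>j = 1..m. S (block A i j \<union> block B (i + j) (m - j))) = 2 * Tb + m * K"
  proof -
    have "(\<Sum>i = 1..m. \<Sum>j = 1..m. b i j) = (\<Sum>i = 1..m. \<Sum>j = 1..m - 1. b i j) + m * K"
      using m by (simp add: split_last K sum.distrib)
    then show ?thesis unfolding Tb_def
      using sum_involution[OF _ bper binv] m by (simp add: b_def)
  qed
  have Qh: "(\<Sum>i = 1..m. \<Sum>j = 1..m. S (block A i (j - 1) \<union> block B (i + j - 1) (m - j))) = Th"
  proof -
    have "(\<Sum>i = 1..m. \<Sum>j = 1..m. S (block A i (j - 1) \<union> block B (i + j - 1) (m - j))) =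
        (\<Sum>i = 1..m. \<Sum>j = 1..m. h (i - 1) j)"
      by (intro sum.cong) (auto simp: h_def)
    also have "\<dots> = Th" unfolding Th_def
      using hper[of 0] by (intro sum_cyclic_shift[of "\<lambda>i. \<Sum>j = 1..m. h i j"]) simp
    finally show ?thesis .
  qed
  have Q: "Q_proj m A B S = Tg + Tb + m * K - Th - K"
    unfolding Q_proj_def sum.distrib Qg Qb Qh K_def by simp

  have reindex: "(\<Sum>i = 1..j. f (m - j + i)) = (\<Sum>t = m - j + 1..m. f t)" if "j \<le> m"
    for f :: "nat \<Rightarrow> real" and j
    by (rule sum.reindex_bij_witness[where i = "\<lambda>t. t - (m - j)" and j = "\<lambda>i. m - j + i"])
      (use that in auto)
  have sG: "(\<Sum>i = 1..m - 1. \<Sum>j = i..m - 1. G i (Suc j) - G i j) =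
      (\<Sum>t = 1..m - 1. g m t) - (\<Sum>t = 1..m. h m t)"
  proof -
    \<comment> \<open>The upper end \<open>G i m\<close> lies in row \<open>m\<close> of
      \<open>g\<close> and \<open>h\<close>, whose blocks start at \<open>A 1\<close>. The rows in
      \<open>sg\<close> and \<open>sh\<close> stop at \<open>m - 1\<close>, so this is the row they
      lack.\<close>
    have "(\<Sum>j = i..m - 1. G i (Suc j) - G i j) =
        g m i - h m i - (S (block A 1 i) - S (block A 1 (i - 1)))" if "i \<in> {1..m - 1}" for i
    proof -
      have "(\<Sum>j = i..m - 1. G i (Suc j) - G i j) = G i m - G i i"
        using that sum_Suc_diff[of i "m - 1" "G i"] Suc_m by simp
      then show ?thesis by (simp add: G_def g_def h_def sA sB)
    qed
    then have "(\<Sum>i = 1..m - 1. \<Sum>j = i..m - 1. G i (Suc j) - G i j) =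
        (\<Sum>i = 1..m - 1. g m i - h m i - (S (block A 1 i) - S (block A 1 (i - 1))))"
      by (intro sum.cong) simp_all
    also have "\<dots> = (\<Sum>i = 1..m - 1. g m i) - (\<Sum>i = 1..m - 1. h m i)
          - (\<Sum>i = 1..m - 1. S (block A 1 i) - S (block A 1 (i - 1)))"
      by (simp only: sum_subtractf)
    \<comment> \<open>The lower ends \<open>G i i\<close> telescope again, now in \<open>i\<close>
      and from \<open>S {} = 0\<close>. What remains is the last entry \<open>t = m\<close> of row
      \<open>m\<close> of \<open>h\<close>.\<close>
    also have "(\<Sum>i = 1..m - 1. S (block A 1 i) - S (block A 1 (i - 1))) = h m m"
    proof -
      have "(\<Sum>i = 1..n. S (block A 1 i) - S (block A 1 (i - 1))) = S (block A 1 n)" for n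
        using S0 by (induction n) simp_all
      then show ?thesis by (simp add: h_def sA)
    qed
    finally show ?thesis using m by (simp add: split_last[of "Suc 0" "h m"])
  qed
  have sg: "(\<Sum>i = 1..m - 1. \<Sum>j = i..m - 1. g j (m - j + i)) =
      Tg - (\<Sum>t = 1..m - 1. g m t) + (m - 1) * K"
  proof -
    have "(\<Sum>i = 1..m - 1. \<Sum>j = i..m - 1. g j (m - j + i)) =
        (\<Sum>j = 1..m - 1. \<Sum>t = m - j + 1..m. g j t)"
      unfolding sum_triangle_swap by (rule sum.cong[OF refl reindex]) auto
    \<comment> \<open>The entry \<open>t = m\<close>, coming from \<open>i = j\<close>, gives one
      \<open>K\<close> in each of \<open>m - 1\<close> rows; this matches \<open>m * K - K\<close>
      in \<open>Q\<close>.\<close>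
    also have "\<dots> = (\<Sum>j = 1..m - 1. (\<Sum>t = m - j + 1..m - 1. g j t) + K)"
      by (intro sum.cong) (auto simp: split_last K)
    finally show ?thesis using m by (simp add: Tg_def split_last[of "Suc 0"] sum.distrib)
  qed
  have sb: "(\<Sum>i = 1..m - 1. \<Sum>j = i..m - 1. b (Suc j) (m - j + i - 1)) = Tb"
  proof -
    have "(\<Sum>i = 1..m - 1. \<Sum>j = i..m - 1. b (Suc j) (m - j + i - 1)) =
        (\<Sum>j = 1..m - 1. \<Sum>t = m - Suc j + 1..m - 1. b (Suc j) t)"
      unfolding sum_triangle_swap
    proof (rule sum.cong[OF refl])
      fix j assume j: "j \<in> {1..m - 1}"
      show "(\<Sum>i = 1..j. b (Suc j) (m - j + i - 1)) = (\<Sum>t = m - Suc j + 1..m - 1. b (Suc j) t)"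
        by (rule sum.reindex_bij_witness[where i = "\<lambda>t. t + 1 - (m - j)" and j = "\<lambda>i. m - j + i - 1"])
          (use j in auto)
    qed
    also have "\<dots> = (\<Sum>s = Suc 1..Suc (m - 1). \<Sum>t = m - s + 1..m - 1. b s t)"
      by (simp only: sum.shift_bounds_cl_Suc_ivl)
    \<comment> \<open>The row \<open>s = 1\<close> missing on the left is empty, as \<open>t\<close>
      would range over \<open>{m..m - 1}\<close>.\<close>
    also have "\<dots> = Tb"
      using m unfolding Tb_def by (simp add: sum.atLeast_Suc_atMost[of "Suc 0" m])
    finally show ?thesis .
  qed
  have sh: "(\<Sum>i = 1..m - 1. \<Sum>j = i..m - 1. h j (m - j + i)) +
      (\<Sum>i = 1..m - 1. \<Sum>j = i..m - 1. h i (j - i + 1)) = Th - (\<Sum>t = 1..m. h m t)"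
  proof -
    have "(\<Sum>i = 1..m - 1. \<Sum>j = i..m - 1. h j (m - j + i)) =
        (\<Sum>j = 1..m - 1. \<Sum>t = m - j + 1..m. h j t)"
      unfolding sum_triangle_swap by (rule sum.cong[OF refl reindex]) auto
    \<comment> \<open>In row \<open>i\<close>, the \<open>ZW\<close> entropies fill
      \<open>t > m - i\<close> and the complemented \<open>XYZW\<close> entropies fill
      \<open>t \<le> m - i\<close>.\<close>
    moreover have "(\<Sum>t = m - i + 1..m. h i t) + (\<Sum>j = i..m - 1. h i (j - i + 1)) =
        (\<Sum>t = 1..m. h i t)" if "i \<in> {1..m - 1}" for i
    proof -
      have "(\<Sum>j = i..m - 1. h i (j - i + 1)) = (\<Sum>t = 1..m - i. h i t)"
        by (rule sum.reindex_bij_witness[where i = "\<lambda>t. t + i - 1" and j = "\<lambda>j. j - i + 1"])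
          (use that in auto)
      moreover have "{1..m} = {1..m - i} \<union> {m - i + 1..m}" using that by auto
      ultimately show ?thesis by (simp add: sum.union_disjoint)
    qed
    ultimately have "(\<Sum>i = 1..m - 1. \<Sum>j = i..m - 1. h j (m - j + i)) +
      (\<Sum>i = 1..m - 1. \<Sum>j = i..m - 1. h i (j - i + 1)) = (\<Sum>i = 1..m - 1. \<Sum>t = 1..m. h i t)"
      by (simp only: sum.distrib[symmetric]) (rule sum.cong, auto)
    then show ?thesis using m by (simp add: Th_def split_last[of "Suc 0" "\<lambda>i. sum (h i) _"])
  qed
  have "(\<Sum>i = 1..m - 1. \<Sum>j = i..m - 1.
      - cond_I3 S {A i} {B j} (block A (j + 1) (m - j)) (block A 1 (i - 1) \<union> block B i (j - i))) =
    (\<Sum>i = 1..m - 1. \<Sum>j = i..m - 1. (G i (Suc j) - G i j) + g j (m - j + i)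
       + b (Suc j) (m - j + i - 1) - h j (m - j + i) - h i (j - i + 1))"
    unfolding G_def g_def b_def h_def
    by (intro sum.cong refl cond_I3_term[OF cyc pure]) auto
  also have "\<dots> = (\<Sum>i = 1..m - 1. \<Sum>j = i..m - 1. G i (Suc j) - G i j)
      + (\<Sum>i = 1..m - 1. \<Sum>j = i..m - 1. g j (m - j + i))
      + (\<Sum>i = 1..m - 1. \<Sum>j = i..m - 1. b (Suc j) (m - j + i - 1))
      - (\<Sum>i = 1..m - 1. \<Sum>j = i..m - 1. h j (m - j + i))
      - (\<Sum>i = 1..m - 1. \<Sum>j = i..m - 1. h i (j - i + 1))"
    by (simp only: sum.distrib sum_subtractf)
  also have "\<dots> = Q_proj m A B S"
    using sh m unfolding Q sG sg sb by (simp add: of_nat_diff algebra_simps)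
  finally show ?thesis by simp
qed

theorem theorem2:
  fixes m :: nat and A B :: "nat \<Rightarrow> 'p"
  assumes "m \<ge> 2"
    and "cyclic_parties m A B"
  shows "TF_compatible (parties m A B) (B m) (Q_proj m A B) \<and>
    (\<forall>i \<in> {1..m - 1}. \<forall>j \<in> {i..m - 1}.
       admissible (parties m A B) (B m)
         {A i} {B j} (block A (j + 1) (m - j)) (block A 1 (i - 1) \<union> block B i (j - i))) \<and>
    (\<forall>S. pure_entropy (parties m A B) S \<longrightarrow>
       Q_proj m A B S =
         (\<Sum>i = 1..m - 1. \<Sum>j = i..m - 1.
            - cond_I3 S {A i} {B j} (block A (j + 1) (m - j))
                (block A 1 (i - 1) \<union> block B i (j - i))))"
proof (intro conjI ballI allI impI)
  let ?f = "\<lambda>i j. ({A i}, {B j}, block A (j + 1) (m - j), block A 1 (i - 1) \<union> block B i (j - i))"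
  let ?ts = "concat (map (\<lambda>i. map (?f i) [i..<m]) [1..<m])"
  have "\<forall>(X, Y, Z, W) \<in> set ?ts. admissible (parties m A B) (B m) X Y Z W"
    using admissible_term[OF assms(2)] by auto
  moreover have "Q_proj m A B S = (\<Sum>(X, Y, Z, W)\<leftarrow>?ts. - cond_I3 S X Y Z W)"
    if "pure_entropy (parties m A B) S" for S
    using Q_proj_eq_sum[OF assms that] assms(1)
    by (subst sum_list_concat_triangle) simp_all
  ultimately show "TF_compatible (parties m A B) (B m) (Q_proj m A B)"
    unfolding TF_compatible_def by (intro exI[of _ ?ts] conjI allI impI)
qed (rule admissible_term[OF assms(2)] Q_proj_eq_sum[OF assms]; assumption)+

end
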